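(* Let $M=\mathrm{Span}\{e_{11},e_{12},e_{13},e_{23},e_{22}+e_{33}\}$. Let $M_3(\mathbb{C})=A\oplus B$ be a direct vector-space sum of two subalgebras with $\dim A=4$ and $\dim B=5$, where $B$ is the image of $M$ under some automorphism or antiautomorphism of $M_3(\mathbb{C})$. Then there is a map $\varphi\colon M_3(\mathbb{C})\to M_3(\mathbb{C})$, which is an automorphism or an antiautomorphism of $M_3(\mathbb{C})$, such that $\varphi(B)=M$ and $\varphi(A)=S$, where $S$ is one of the following subalgebras: (X1) $\mathrm{Span}\{e_{21},e_{22},e_{31},e_{32}\}$; (X2) $\mathrm{Span}\{e_{21},e_{31},e_{32},e_{33}\}$; (X3) $\mathrm{Span}\{e_{21},e_{31},e_{32},e_{11}+e_{22}\}$; (X4) $\mathrm{Span}\{e_{21},e_{31},e_{32},e_{11}+e_{33}\}$; (X5) $\mathrm{Span}\{e_{11}+e_{31},e_{12}+e_{32},e_{21},e_{22}\}$; (X6) $\mathrm{Span}\{e_{21}+e_{12},e_{31},e_{32},e_{11}+e_{22}\}$; (X7) $\mathrm{Span}\{e_{21}+e_{22},e_{31},e_{32},e_{33}\}$.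
   Context: $M_3(\mathbb{C})$ is the algebra of $3\times3$ complex matrices, $e_{ij}$ are the matrix units, and $\mathrm{Span}$ means linear span over $\mathbb{C}$. A subalgebra is a $\mathbb{C}$-linear subspace closed under multiplication; it is not required to contain the identity matrix. An automorphism is a $\mathbb{C}$-algebra automorphism of $M_3(\mathbb{C})$; an antiautomorphism is the composition of an automorphism and the transpose map. The phrase "up to transpose and up to action of $\mathrm{Aut}(M_3(\mathbb{C}))$" is expressed in the claim by the existence of $\varphi$. *)

theory Defs
  imports "HOL-Analysis.Analysis"
begin

(* The library operation *s on complex^3^3 has scalars in complex^3, not in complex,
   and *\<^sub>R only has real scalars, so the complex vector space structure
   of the matrix algebra is introduced here. *)
definition mscale :: "complex \<Rightarrow> complex^3^3 \<Rightarrow> complex^3^3"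
  where "mscale c X = (\<chi> i j. c * X $ i $ j)"

global_interpretation mat3: vector_space mscale
  by standard (simp_all add: mscale_def vec_eq_iff algebra_simps)

(* The index type 3 has the three distinct elements 1, 2 and 3 (where 3 = 0). *)
definition E :: "3 \<Rightarrow> 3 \<Rightarrow> complex^3^3"
  where "E i j = (\<chi> k l. if k = i \<and> l = j then 1 else 0)"

definition subalgebra :: "(complex^3^3) set \<Rightarrow> bool"
  where "subalgebra A \<longleftrightarrow> mat3.subspace A \<and> (\<forall>X\<in>A. \<forall>Y\<in>A. X ** Y \<in> A)"

(* Preservation of the identity matrix follows from surjectivity. *)
definition automorphism :: "(complex^3^3 \<Rightarrow> complex^3^3) \<Rightarrow> bool"
  where "automorphism f \<longleftrightarrow>
    bij f \<and> Vector_Spaces.linear mscale mscale f \<and> (\<forall>X Y. f (X ** Y) = f X ** f Y)"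

definition antiautomorphism :: "(complex^3^3 \<Rightarrow> complex^3^3) \<Rightarrow> bool"
  where "antiautomorphism f \<longleftrightarrow> (\<exists>g. automorphism g \<and> f = g \<circ> transpose)"

definition direct_decomposition :: "(complex^3^3) set \<Rightarrow> (complex^3^3) set \<Rightarrow> bool"
  where "direct_decomposition A B \<longleftrightarrow>
    {X + Y | X Y. X \<in> A \<and> Y \<in> B} = UNIV \<and> A \<inter> B = {0}"

definition M :: "(complex^3^3) set"
  where "M = mat3.span {E 1 1, E 1 2, E 1 3, E 2 3, E 2 2 + E 3 3}"

end

theory Submission
  imports Defs
begin

text \<open>
  Applying \<open>\<psi>\<^sup>-\<^sup>1\<close> reduces everything to \<open>B = M\<close>. The set \<open>M\<close> consists of the upper triangular
  matrices whose last two diagonal entries agree, so conjugation by any invertible upper triangular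
  matrix maps \<open>M\<close> to itself; these conjugations suffice to normalise \<open>A\<close>.

  A matrix modulo \<open>M\<close> is given by its three entries below the diagonal and by the difference of the
  \<open>(2,2)\<close> and \<open>(3,3)\<close> entries. As \<open>A\<close> is a complement of \<open>M\<close>, these four numbers are coordinates on
  \<open>A\<close>. In particular \<open>A\<close> contains an upper triangular \<open>u\<close>, unique up to a factor, whose last two
  diagonal entries differ by one. Then \<open>u\<^sup>2\<close> is again upper triangular and in \<open>A\<close>, hence a multiple
  of \<open>u\<close>, which makes \<open>u\<close> or \<open>-u\<close> an idempotent with diagonal \<open>(a,1,0)\<close> or \<open>(a,0,1)\<close>,
  \<open>a \<in> {0,1}\<close> (\<open>contains_triangular_idempotent\<close>). An upper triangular idempotent is conjugate to its
  own diagonal by an upper unitriangular matrix (\<open>idempotent_diagonalised\<close>), so \<open>A\<close> may be assumed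
  to contain one of \<open>e\<^sub>2\<^sub>2\<close>, \<open>e\<^sub>3\<^sub>3\<close>, \<open>e\<^sub>1\<^sub>1 + e\<^sub>2\<^sub>2\<close>, \<open>e\<^sub>1\<^sub>1 + e\<^sub>3\<^sub>3\<close>.

  Call this idempotent \<open>D\<close>. With \<open>X\<close>, the algebra \<open>A\<close> contains the Peirce components
  \<open>D X D\<close>, \<open>D X (1 - D)\<close>, \<open>(1 - D) X D\<close> and \<open>(1 - D) X (1 - D)\<close>. Taking for \<open>X\<close> the elements of
  \<open>A\<close> congruent to \<open>e\<^sub>2\<^sub>1\<close>, \<open>e\<^sub>3\<^sub>1\<close> or \<open>e\<^sub>3\<^sub>2\<close> modulo \<open>M\<close>, a suitable component leaves so few
  undetermined entries that a basis of \<open>A\<close> can be written down. For \<open>D = e\<^sub>3\<^sub>3\<close> and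
  \<open>D = e\<^sub>1\<^sub>1 + e\<^sub>3\<^sub>3\<close> there is one further relation between these entries, because the identity matrix
  lies in \<open>M\<close> and hence not in \<open>A\<close>. A unipotent conjugation commuting with \<open>D\<close> then removes all
  but at most one parameter, and a diagonal conjugation scales the last one to one if it is not
  zero. Each of the first three choices of \<open>D\<close> gives two of the seven algebras, according to
  whether this parameter vanishes, and \<open>e\<^sub>1\<^sub>1 + e\<^sub>3\<^sub>3\<close> gives a single one.
\<close>

section \<open>Matrices by their entries\<close>

definition mat33 :: "complex \<Rightarrow> complex \<Rightarrow> complex \<Rightarrow> complex \<Rightarrow> complex \<Rightarrow> complex
    \<Rightarrow> complex \<Rightarrow> complex \<Rightarrow> complex \<Rightarrow> complex^3^3"
  where "mat33 a b c d e f g h i = vector [vector [a, b, c], vector [d, e, f], vector [g, h, i]]"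

lemma mat33_nth [simp]:
  "mat33 a b c d e f g h i $ 1 $ 1 = a" "mat33 a b c d e f g h i $ 1 $ 2 = b"
  "mat33 a b c d e f g h i $ 1 $ 3 = c" "mat33 a b c d e f g h i $ 2 $ 1 = d"
  "mat33 a b c d e f g h i $ 2 $ 2 = e" "mat33 a b c d e f g h i $ 2 $ 3 = f"
  "mat33 a b c d e f g h i $ 3 $ 1 = g" "mat33 a b c d e f g h i $ 3 $ 2 = h"
  "mat33 a b c d e f g h i $ 3 $ 3 = i"
  by (simp_all add: mat33_def)

lemma matrix3_eq_iff:
  fixes X Y :: "complex^3^3"
  shows "X = Y \<longleftrightarrow>
    X $ 1 $ 1 = Y $ 1 $ 1 \<and> X $ 1 $ 2 = Y $ 1 $ 2 \<and> X $ 1 $ 3 = Y $ 1 $ 3 \<and>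
    X $ 2 $ 1 = Y $ 2 $ 1 \<and> X $ 2 $ 2 = Y $ 2 $ 2 \<and> X $ 2 $ 3 = Y $ 2 $ 3 \<and>
    X $ 3 $ 1 = Y $ 3 $ 1 \<and> X $ 3 $ 2 = Y $ 3 $ 2 \<and> X $ 3 $ 3 = Y $ 3 $ 3"
  by (auto simp: vec_eq_iff forall_3)

lemma mat33_cases:
  obtains a b c d e f g h i where "X = mat33 a b c d e f g h i"
proof
  show "X = mat33 (X$1$1) (X$1$2) (X$1$3) (X$2$1) (X$2$2) (X$2$3) (X$3$1) (X$3$2) (X$3$3)"
    by (simp add: matrix3_eq_iff)
qed

lemma mat33_inject [simp]:
  "mat33 a b c d e f g h i = mat33 a' b' c' d' e' f' g' h' i' \<longleftrightarrow>
    a = a' \<and> b = b' \<and> c = c' \<and> d = d' \<and> e = e' \<and> f = f' \<and> g = g' \<and> h = h' \<and> i = i'"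
  by (auto simp: matrix3_eq_iff)

lemma mat33_algebra [simp]:
  "mat33 a b c d e f g h i + mat33 a' b' c' d' e' f' g' h' i' =
    mat33 (a+a') (b+b') (c+c') (d+d') (e+e') (f+f') (g+g') (h+h') (i+i')"
  "mat33 a b c d e f g h i - mat33 a' b' c' d' e' f' g' h' i' =
    mat33 (a-a') (b-b') (c-c') (d-d') (e-e') (f-f') (g-g') (h-h') (i-i')"
  "mscale k (mat33 a b c d e f g h i) = mat33 (k*a) (k*b) (k*c) (k*d) (k*e) (k*f) (k*g) (k*h) (k*i)"
  "mat33 a b c d e f g h i ** mat33 a' b' c' d' e' f' g' h' i' =
    mat33 (a*a'+b*d'+c*g') (a*b'+b*e'+c*h') (a*c'+b*f'+c*i')
          (d*a'+e*d'+f*g') (d*b'+e*e'+f*h') (d*c'+e*f'+f*i')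
          (g*a'+h*d'+i*g') (g*b'+h*e'+i*h') (g*c'+h*f'+i*i')"
  by (simp_all add: matrix3_eq_iff mscale_def matrix_matrix_mult_def sum_3)

lemma mat33_constants:
  "0 = mat33 0 0 0 0 0 0 0 0 0"
  "mat 1 = mat33 1 0 0 0 1 0 0 0 1"
  "E 1 1 = mat33 1 0 0 0 0 0 0 0 0" "E 1 2 = mat33 0 1 0 0 0 0 0 0 0"
  "E 1 3 = mat33 0 0 1 0 0 0 0 0 0" "E 2 1 = mat33 0 0 0 1 0 0 0 0 0"
  "E 2 2 = mat33 0 0 0 0 1 0 0 0 0" "E 2 3 = mat33 0 0 0 0 0 1 0 0 0"
  "E 3 1 = mat33 0 0 0 0 0 0 1 0 0" "E 3 2 = mat33 0 0 0 0 0 0 0 1 0"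
  "E 3 3 = mat33 0 0 0 0 0 0 0 0 1"
  by (simp_all add: matrix3_eq_iff E_def mat_def)

lemma M_iff: "mat33 a b c d e f g h i \<in> M \<longleftrightarrow> d = 0 \<and> g = 0 \<and> h = 0 \<and> e = i"
  unfolding M_def mat3.span_breakdown_eq mat3.span_empty
  by (auto simp: mat33_constants)

lemma subalgebra_closed:
  assumes "subalgebra A"
  shows "X \<in> A \<Longrightarrow> Y \<in> A \<Longrightarrow> X + Y \<in> A" "X \<in> A \<Longrightarrow> Y \<in> A \<Longrightarrow> X - Y \<in> A"
    "X \<in> A \<Longrightarrow> mscale k X \<in> A" "X \<in> A \<Longrightarrow> Y \<in> A \<Longrightarrow> X ** Y \<in> A"
  using assms
  by (auto simp: subalgebra_def mat3.subspace_add mat3.subspace_diff mat3.subspace_scale)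

section \<open>Complements of \<open>M\<close>\<close>

definition complements_M :: "(complex^3^3) set \<Rightarrow> bool"
  where "complements_M A \<longleftrightarrow> subalgebra A \<and> A \<inter> M = {0} \<and> (\<forall>X. \<exists>Y\<in>A. X - Y \<in> M)"

text \<open>
  A complement of \<open>M\<close> cannot properly contain another one: this identifies \<open>A\<close> from a few of its
  elements without computing dimensions.
\<close>
lemma complements_M_eq_span:
  assumes A: "complements_M A" and S: "S \<subseteq> A" and ex: "\<And>X. \<exists>Y\<in>mat3.span S. X - Y \<in> M"
  shows "A = mat3.span S"
proof
  have sub: "subalgebra A" and disj: "A \<inter> M = {0}" using A by (auto simp: complements_M_def)
  show le: "mat3.span S \<subseteq> A"
    using S sub by (simp add: mat3.span_minimal subalgebra_def)
  show "A \<subseteq> mat3.span S"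
  proof
    fix X assume X: "X \<in> A"
    obtain Y where Y: "Y \<in> mat3.span S" "X - Y \<in> M" using ex by blast
    then have "X - Y \<in> A \<inter> M" using le X subalgebra_closed(2)[OF sub] by auto
    then show "X \<in> mat3.span S" using disj Y by auto
  qed
qed

text \<open>
  The numbers \<open>x\<close>, \<open>y\<close>, \<open>z\<close>, \<open>s\<close> are the coordinates modulo \<open>M\<close> of an element of \<open>A\<close>, and
  they can be prescribed.
\<close>
lemma lift_modulo_M:
  assumes "complements_M A"
  obtains a b c f i where "mat33 a b c x (s + i) f y z i \<in> A"
proof -
  obtain Y where Y: "Y \<in> A" "mat33 0 0 0 x s 0 y z 0 - Y \<in> M"
    using assms unfolding complements_M_def by blast
  obtain a b c d e f g h i where Ye: "Y = mat33 a b c d e f g h i" by (rule mat33_cases)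
  show thesis
    using Y that[of a b c i f] by (auto simp: Ye M_iff algebra_simps)
qed

lemma complements_M_eq_span4:
  assumes A: "complements_M A" and S: "{U, V, W, Z} \<subseteq> A"
    and ex: "\<And>a b c d e f g h i. \<exists>k l m n. mat33 a b c d e f g h i -
      (mscale k U + (mscale l V + (mscale m W + mscale n Z))) \<in> M"
  shows "A = mat3.span {U, V, W, Z}"
proof (rule complements_M_eq_span[OF A S])
  fix X
  obtain a b c d e f g h i where X: "X = mat33 a b c d e f g h i" by (rule mat33_cases)
  obtain k l m n where "X - (mscale k U + (mscale l V + (mscale m W + mscale n Z))) \<in> M"
    using ex X by blast
  then show "\<exists>Y\<in>mat3.span {U, V, W, Z}. X - Y \<in> M"
    by (rule bexI) (intro mat3.span_add mat3.span_scale mat3.span_base; simp)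
qed

section \<open>Triangular conjugations\<close>

text \<open>
  The inverse is kept as an explicit second matrix, so that conjugating a concrete matrix is a
  computation with entries.
\<close>
definition triangular_pair :: "complex^3^3 \<Rightarrow> complex^3^3 \<Rightarrow> bool"
  where "triangular_pair T S \<longleftrightarrow> T ** S = mat 1 \<and> S ** T = mat 1 \<and>
    T $ 2 $ 1 = 0 \<and> T $ 3 $ 1 = 0 \<and> T $ 3 $ 2 = 0 \<and> S $ 2 $ 1 = 0 \<and> S $ 3 $ 1 = 0 \<and> S $ 3 $ 2 = 0"

definition conj_by :: "complex^3^3 \<Rightarrow> complex^3^3 \<Rightarrow> complex^3^3 \<Rightarrow> complex^3^3"
  where "conj_by T S X = T ** X ** S"

lemma triangular_pair_swap: "triangular_pair T S \<Longrightarrow> triangular_pair S T"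
  by (auto simp: triangular_pair_def)

lemma conj_by_inverse:
  assumes "triangular_pair T S"
  shows "conj_by S T (conj_by T S X) = X" "conj_by T S (conj_by S T X) = X"
proof -
  have ST: "S ** T = mat 1" "T ** S = mat 1" using assms by (auto simp: triangular_pair_def)
  have "conj_by S T (conj_by T S X) = (S ** T) ** X ** (S ** T)"
    "conj_by T S (conj_by S T X) = (T ** S) ** X ** (T ** S)"
    by (simp_all add: conj_by_def matrix_mul_assoc)
  then show "conj_by S T (conj_by T S X) = X" "conj_by T S (conj_by S T X) = X"
    by (simp_all add: ST)
qed

lemma automorphism_conj_by:
  assumes "triangular_pair T S"
  shows "automorphism (conj_by T S)"
proof -
  have ST: "S ** T = mat 1" using assms by (auto simp: triangular_pair_def)
  have "bij (conj_by T S)"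
    using conj_by_inverse[OF assms] by (intro o_bij[of "conj_by S T"]) auto
  moreover have "Vector_Spaces.linear mscale mscale (conj_by T S)"
  proof (unfold Vector_Spaces.linear_iff, intro conjI allI)
    show "conj_by T S (X + Y) = conj_by T S X + conj_by T S Y" for X Y
      by (simp add: conj_by_def matrix3_eq_iff matrix_matrix_mult_def sum_3 algebra_simps)
    show "conj_by T S (mscale k X) = mscale k (conj_by T S X)" for k X
      by (simp add: conj_by_def matrix3_eq_iff mscale_def matrix_matrix_mult_def sum_3 algebra_simps)
  qed (unfold_locales)
  moreover have "conj_by T S (X ** Y) = conj_by T S X ** conj_by T S Y" for X Y
  proof -
    have "conj_by T S X ** conj_by T S Y = T ** X ** (S ** T) ** Y ** S"
      by (simp add: conj_by_def matrix_mul_assoc)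
    then show ?thesis by (simp add: ST conj_by_def matrix_mul_assoc)
  qed
  ultimately show ?thesis by (simp add: automorphism_def)
qed

lemma conj_by_M_iff:
  assumes "triangular_pair T S"
  shows "conj_by T S X \<in> M \<longleftrightarrow> X \<in> M"
proof -
  have *: "conj_by T S X \<in> M" if TS: "triangular_pair T S" and X: "X \<in> M" for T S X
  proof -
    obtain a b c d e f g h i where T: "T = mat33 a b c d e f g h i" by (rule mat33_cases)
    obtain a' b' c' d' e' f' g' h' i' where S: "S = mat33 a' b' c' d' e' f' g' h' i'"
      by (rule mat33_cases)
    obtain p q r s t u v w x where Xe: "X = mat33 p q r s t u v w x" by (rule mat33_cases)
    have "e * e' = 1" "i * i' = 1"
      using TS by (auto simp: triangular_pair_def T S mat33_constants)
    \<comment> \<open>The last two diagonal entries of the conjugate; both equal \<open>x\<close>.\<close>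
    then have "e * x * e' = i * x * i'"
      by (metis mult.commute mult.left_commute)
    then show ?thesis
      using TS X by (auto simp: triangular_pair_def T S Xe M_iff conj_by_def)
  qed
  show ?thesis
    using *[OF assms] *[OF triangular_pair_swap[OF assms]] conj_by_inverse(1)[OF assms] by metis
qed

text \<open>
  This transports decompositions both along \<open>\<psi>\<^sup>-\<^sup>1\<close>, which may reverse products, and along
  triangular conjugations.
\<close>
lemma complements_M_image:
  assumes A: "subalgebra A" and dec: "\<And>X. \<exists>Y\<in>A. X - Y \<in> B" and disj: "A \<inter> B = {0}"
    and f: "bij f" "Vector_Spaces.linear mscale mscale f"
    and mult: "(\<forall>X Y. f (X ** Y) = f X ** f Y) \<or> (\<forall>X Y. f (X ** Y) = f Y ** f X)"
    and B: "f ` B = M"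
  shows "complements_M (f ` A)"
  unfolding complements_M_def
proof (intro conjI allI)
  interpret f: Vector_Spaces.linear mscale mscale f by (rule f)
  show "subalgebra (f ` A)"
    using A mult unfolding subalgebra_def
    by (auto simp: f.subspace_image) (metis imageI)+
  have "f ` A \<inter> M = f ` (A \<inter> B)" using f(1) B by (auto simp: bij_def inj_def)
  then show "f ` A \<inter> M = {0}" by (simp add: disj f.zero)
  fix X
  obtain X' where X': "X = f X'" using f(1) by (metis bij_pointE)
  obtain Y where "Y \<in> A" "X' - Y \<in> B" using dec by blast
  then show "\<exists>Y\<in>f ` A. X - Y \<in> M"
    using B X' by (auto simp: f.diff[symmetric] intro!: bexI[of _ Y])
qed

lemma conj_by_image_M:
  assumes TS: "triangular_pair T S"
  shows "conj_by T S ` M = M"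
proof safe
  show "X \<in> conj_by T S ` M" if "X \<in> M" for X
    using that conj_by_M_iff[OF TS, of "conj_by S T X"] conj_by_inverse[OF TS, of X]
    by (intro image_eqI[of _ _ "conj_by S T X"]) auto
qed (use conj_by_M_iff[OF TS] in auto)

lemma complements_M_conj_by:
  assumes A: "complements_M A" and TS: "triangular_pair T S"
  shows "complements_M (conj_by T S ` A)"
proof (rule complements_M_image[of A M])
  show "conj_by T S ` M = M" by (rule conj_by_image_M[OF TS])
qed (use A automorphism_conj_by[OF TS] in \<open>auto simp: complements_M_def automorphism_def\<close>)

lemma triangular_pair_unipotent:
  "triangular_pair (mat33 1 x y 0 1 z 0 0 1) (mat33 1 (- x) (x * z - y) 0 1 (- z) 0 0 1)"
  by (simp add: triangular_pair_def mat33_constants algebra_simps)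

lemma triangular_pair_torus:
  "k \<noteq> 0 \<Longrightarrow> l \<noteq> 0 \<Longrightarrow> triangular_pair (mat33 k 0 0 0 l 0 0 0 1) (mat33 (1/k) 0 0 0 (1/l) 0 0 0 1)"
  by (simp add: triangular_pair_def mat33_constants)

lemma triangular_pair_compose:
  assumes "triangular_pair T S" "triangular_pair T' S'"
  shows "triangular_pair (T' ** T) (S ** S')"
proof -
  have "(T' ** T) ** (S ** S') = T' ** (T ** S) ** S'"
    "(S ** S') ** (T' ** T) = S ** (S' ** T') ** T"
    by (simp_all add: matrix_mul_assoc)
  moreover have "(T' ** T) $ 2 $ 1 = 0 \<and> (T' ** T) $ 3 $ 1 = 0 \<and> (T' ** T) $ 3 $ 2 = 0"
    "(S ** S') $ 2 $ 1 = 0 \<and> (S ** S') $ 3 $ 1 = 0 \<and> (S ** S') $ 3 $ 2 = 0"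
    using assms by (auto simp: triangular_pair_def matrix_matrix_mult_def sum_3)
  ultimately show ?thesis
    using assms by (auto simp: triangular_pair_def)
qed

lemma conj_by_compose: "conj_by T' S' ` conj_by T S ` A = conj_by (T' ** T) (S ** S') ` A"
  by (simp add: image_image conj_by_def matrix_mul_assoc)

section \<open>A diagonal idempotent\<close>

text \<open>
  The upper triangular matrices contain \<open>M\<close> with codimension one, so \<open>A\<close> meets them in a line. The
  square of a generator \<open>u\<close> of this line is \<open>t u\<close> with \<open>t\<close> the sum of the last two diagonal entries,
  by comparing these entries; and one of the two entries vanishes, so \<open>t = 1\<close> or \<open>t = -1\<close>.
\<close>
lemma contains_triangular_idempotent:
  assumes A: "complements_M A"
  obtains a b c d e where "mat33 a b c 0 d e 0 0 (1 - d) \<in> A"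
    "a = 0 \<or> a = 1" "d = 0 \<or> d = 1"
    "mat33 a b c 0 d e 0 0 (1 - d) ** mat33 a b c 0 d e 0 0 (1 - d) = mat33 a b c 0 d e 0 0 (1 - d)"
proof -
  have sub: "subalgebra A" and disj: "A \<inter> M = {0}" using A by (auto simp: complements_M_def)
  obtain a b c e f where u: "mat33 a b c 0 (1 + f) e 0 0 f \<in> A"
    by (rule lift_modulo_M[OF A, of 0 1 0 0]) simp
  define u where "u = mat33 a b c 0 (1 + f) e 0 0 f"
  define t where "t = 1 + 2 * f"
  have "u ** u - mscale t u \<in> A"
    using u unfolding u_def by (intro subalgebra_closed[OF sub])
  moreover have "u ** u - mscale t u \<in> M"
    by (simp add: u_def t_def M_iff algebra_simps)
  ultimately have eq: "u ** u - mscale t u = 0" using disj by blast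
  then have "(1 + f) * (1 + f) - t * (1 + f) = 0"
    by (simp add: u_def mat33_constants)
  moreover have "(1 + f) * (1 + f) - t * (1 + f) = - (f * (1 + f))"
    by (simp add: t_def algebra_simps)
  ultimately have "f * (1 + f) = 0" by simp
  then consider "f = 0" | "f = -1"
    by (metis add.commute add_eq_0_iff mult_eq_0_iff)
  then show thesis
  proof cases
    case 1
    show ?thesis
      using eq u 1 by (intro that[of a b c 1 e]) (auto simp: u_def t_def mat33_constants)
  next
    case 2
    have "mscale (-1) (mat33 a b c 0 0 e 0 0 (-1)) \<in> A"
      using subalgebra_closed(3)[OF sub u, of "-1"] 2 by simp
    moreover have "a * (1 + a) = 0"
      using eq 2 by (simp add: u_def t_def mat33_constants algebra_simps)
    then have "a = 0 \<or> a = -1"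
      by (metis add.commute add_eq_0_iff mult_eq_0_iff)
    ultimately show ?thesis
      using eq 2 by (intro that[of "-a" "-b" "-c" 0 "-e"]) (auto simp: u_def t_def mat33_constants)
  qed
qed

text \<open>
  If \<open>P\<close> is an upper triangular idempotent with diagonal part \<open>D\<close>, then
  \<open>T = P D + (1 - P) (1 - D)\<close> satisfies \<open>P T = P D = T D\<close>, and it is unitriangular because each
  diagonal entry \<open>\<delta>\<close> of \<open>D\<close> is \<open>0\<close> or \<open>1\<close> and so \<open>\<delta>\<^sup>2 + (1 - \<delta>)\<^sup>2 = 1\<close>.
\<close>
lemma idempotent_diagonalised:
  assumes A: "complements_M A"
  obtains T S a d where "triangular_pair T S" "a = 0 \<or> a = 1" "d = 0 \<or> d = 1"
    "mat33 a 0 0 0 d 0 0 0 (1 - d) \<in> conj_by T S ` A"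
proof -
  obtain a b c d e where P: "mat33 a b c 0 d e 0 0 (1 - d) \<in> A" and ad: "a = 0 \<or> a = 1" "d = 0 \<or> d = 1"
    and idem: "mat33 a b c 0 d e 0 0 (1 - d) ** mat33 a b c 0 d e 0 0 (1 - d) = mat33 a b c 0 d e 0 0 (1 - d)"
    by (rule contains_triangular_idempotent[OF A])
  \<comment> \<open>The entries above the diagonal of \<open>P D + (1 - P) (1 - D)\<close>.\<close>
  define x y z where "x = b * (2 * d - 1)" and "y = c * (1 - 2 * d)" and "z = e * (1 - 2 * d)"
  define T S where "T = mat33 1 x y 0 1 z 0 0 1" and "S = mat33 1 (- x) (x * z - y) 0 1 (- z) 0 0 1"
  have "conj_by S T (mat33 a b c 0 d e 0 0 (1 - d)) = mat33 a 0 0 0 d 0 0 0 (1 - d)"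
    using ad idem by (auto simp: conj_by_def T_def S_def x_def y_def z_def algebra_simps)
  then have "mat33 a 0 0 0 d 0 0 0 (1 - d) \<in> conj_by S T ` A"
    using P by (metis imageI)
  then show thesis
    using that ad triangular_pair_unipotent triangular_pair_swap unfolding T_def S_def by blast
qed

section \<open>Normal forms for each idempotent\<close>

definition normal_forms :: "(complex^3^3) set set"
  where "normal_forms = {
    mat3.span {E 2 1, E 2 2, E 3 1, E 3 2},
    mat3.span {E 2 1, E 3 1, E 3 2, E 3 3},
    mat3.span {E 2 1, E 3 1, E 3 2, E 1 1 + E 2 2},
    mat3.span {E 2 1, E 3 1, E 3 2, E 1 1 + E 3 3},
    mat3.span {E 1 1 + E 3 1, E 1 2 + E 3 2, E 2 1, E 2 2},
    mat3.span {E 2 1 + E 1 2, E 3 1, E 3 2, E 1 1 + E 2 2},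
    mat3.span {E 2 1 + E 2 2, E 3 1, E 3 2, E 3 3}}"

definition has_normal_form :: "(complex^3^3) set \<Rightarrow> bool"
  where "has_normal_form A \<longleftrightarrow> (\<exists>T S. triangular_pair T S \<and> conj_by T S ` A \<in> normal_forms)"

lemma has_normal_form_conj_by:
  assumes "triangular_pair T S" "has_normal_form (conj_by T S ` A)"
  shows "has_normal_form A"
  using assms triangular_pair_compose unfolding has_normal_form_def conj_by_compose by blast

lemma has_normal_form_span4:
  assumes "complements_M A" "{U, V, W, Z} \<subseteq> A" and "mat3.span {U, V, W, Z} \<in> normal_forms"
    and "\<And>a b c d e f g h i. \<exists>k l m n. mat33 a b c d e f g h i -
      (mscale k U + (mscale l V + (mscale m W + mscale n Z))) \<in> M"
  shows "has_normal_form A"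
proof -
  have "conj_by (mat 1) (mat 1) ` A = A" by (simp add: conj_by_def)
  moreover have "triangular_pair (mat 1) (mat 1)" by (simp add: triangular_pair_def) (simp add: mat_def)
  ultimately show ?thesis
    using complements_M_eq_span4[OF assms(1,2,4)] assms(3) unfolding has_normal_form_def by metis
qed

lemma conj_by_imageI: "X \<in> A \<Longrightarrow> conj_by T S X = Y \<Longrightarrow> Y \<in> conj_by T S ` A"
  by blast

text \<open>
  Here \<open>A\<close> contains \<open>e\<^sub>2\<^sub>1 + f e\<^sub>2\<^sub>3\<close> and \<open>b' e\<^sub>1\<^sub>2 + e\<^sub>3\<^sub>2\<close>, and their product is the fourth basis
  element. Conjugation by \<open>1 + t e\<^sub>1\<^sub>3\<close> replaces \<open>(b', f)\<close> by \<open>(b' + t, f - t)\<close>, so only the sum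
  \<open>s = b' + f\<close> matters. For \<open>s \<noteq> 0\<close> the algebra is a nonunital embedding of the algebra of
  \<open>2 \<times> 2\<close> matrices, while for \<open>s = 0\<close> it has a radical.
\<close>
lemma has_normal_form_if_e22:
  assumes A: "complements_M A" and D: "mat33 0 0 0 0 1 0 0 0 0 \<in> A"
  shows "has_normal_form A"
proof -
  have sub: "subalgebra A" using A by (simp add: complements_M_def)
  note closed = subalgebra_closed[OF sub]
  obtain a b c f i where "mat33 a b c 1 (0 + i) f 0 0 i \<in> A" by (rule lift_modulo_M[OF A])
  \<comment> \<open>The Peirce component \<open>D X (1 - D) = D X - D X D\<close> of the lift \<open>X\<close> of \<open>e\<^sub>2\<^sub>1\<close>.\<close>
  note closed(2)[OF closed(4)[OF D this] closed(4)[OF closed(4)[OF D this] D]]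
  then have p: "mat33 0 0 0 1 0 f 0 0 0 \<in> A" by simp
  obtain a' b' c' f' i' where "mat33 a' b' c' 0 (0 + i') f' 0 1 i' \<in> A" by (rule lift_modulo_M[OF A])
  note closed(2)[OF closed(4)[OF this D] closed(4)[OF D closed(4)[OF this D]]]
  then have r: "mat33 0 b' 0 0 0 0 0 1 0 \<in> A" by simp
  have q: "mat33 b' 0 (b' * f) 0 0 0 1 0 f \<in> A" using closed(4)[OF r p] by simp
  define s where "s = b' + f"
  define T S where "T = mat33 1 0 f 0 1 0 0 0 1" and "S = mat33 1 0 (- f) 0 1 0 0 0 1"
  have TS: "triangular_pair T S"
    using triangular_pair_unipotent[of 0 f 0] by (simp add: T_def S_def)
  define A' where "A' = conj_by T S ` A"
  have A': "complements_M A'" unfolding A'_def by (rule complements_M_conj_by[OF A TS])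
  note image = conj_by_imageI[where T = T and S = S and A = A, folded A'_def]
  note calc = conj_by_def T_def S_def s_def algebra_simps
  have mem: "mat33 0 0 0 0 1 0 0 0 0 \<in> A'" "mat33 0 0 0 1 0 0 0 0 0 \<in> A'"
    "mat33 0 s 0 0 0 0 0 1 0 \<in> A'" "mat33 s 0 0 0 0 0 1 0 0 \<in> A'"
    by (rule image[OF D] image[OF p] image[OF r] image[OF q]; simp add: calc)+
  have "has_normal_form A'"
  proof (cases "s = 0")
    case True
    show ?thesis
    proof (rule has_normal_form_span4[OF A'])
      show "\<exists>k l m n. mat33 a b c d e f g h i - (mscale k (E 2 1) +
          (mscale l (E 2 2) + (mscale m (E 3 1) + mscale n (E 3 2)))) \<in> M" for a b c d e f g h i
        by (intro exI[of _ d] exI[of _ "e - i"] exI[of _ g] exI[of _ h]) (simp add: mat33_constants M_iff)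
    qed (use mem True in \<open>auto simp: mat33_constants normal_forms_def\<close>)
  next
    case False
    define T' S' where "T' = mat33 (1/s) 0 0 0 1 0 0 0 1" and "S' = mat33 s 0 0 0 1 0 0 0 1"
    have TS': "triangular_pair T' S'"
      using triangular_pair_torus[of "1/s" 1] False by (simp add: T'_def S'_def)
    define A'' where "A'' = conj_by T' S' ` A'"
    have A'': "complements_M A''" unfolding A''_def by (rule complements_M_conj_by[OF A' TS'])
    note image = conj_by_imageI[where T = T' and S = S' and A = A', folded A''_def]
    have sub': "subalgebra A'" using A' by (simp add: complements_M_def)
    note scaled = subalgebra_closed(3)[OF sub', where k = "1/s"]
    note calc = conj_by_def T'_def S'_def False
    have mem': "mat33 0 0 0 0 1 0 0 0 0 \<in> A''" "mat33 0 0 0 1 0 0 0 0 0 \<in> A''"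
      "mat33 0 1 0 0 0 0 0 1 0 \<in> A''" "mat33 1 0 0 0 0 0 1 0 0 \<in> A''"
      by (rule image[OF mem(1)] image[OF scaled[OF mem(2)]] image[OF mem(3)]
          image[OF scaled[OF mem(4)]]; simp add: calc)+
    have "has_normal_form A''"
    proof (rule has_normal_form_span4[OF A''])
      show "\<exists>k l m n. mat33 a b c d e f g h i - (mscale k (E 1 1 + E 3 1) +
          (mscale l (E 1 2 + E 3 2) + (mscale m (E 2 1) + mscale n (E 2 2)))) \<in> M" for a b c d e f g h i
        by (intro exI[of _ g] exI[of _ h] exI[of _ d] exI[of _ "e - i"]) (simp add: mat33_constants M_iff)
    qed (use mem' in \<open>auto simp: mat33_constants normal_forms_def\<close>)
    then show ?thesis
      using has_normal_form_conj_by[OF TS'] A''_def by blast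
  qed
  then show ?thesis using has_normal_form_conj_by[OF TS] A'_def by blast
qed

text \<open>
  The Peirce components give \<open>e\<^sub>3\<^sub>1\<close>, \<open>e\<^sub>3\<^sub>2\<close> and an element \<open>p\<close> of the upper left \<open>2 \<times> 2\<close> corner
  with \<open>(2,1)\<close> entry one. If \<open>p\<close> had nonzero determinant, the identity of the corner would be a
  polynomial in \<open>p\<close> without constant term, so \<open>A\<close> would contain the identity matrix. Hence \<open>p\<close> has
  rank one, and only its trace \<open>s\<close> survives conjugation.
\<close>
lemma has_normal_form_if_e33:
  assumes A: "complements_M A" and D: "mat33 0 0 0 0 0 0 0 0 1 \<in> A"
  shows "has_normal_form A"
proof -
  have sub: "subalgebra A" and disj: "A \<inter> M = {0}" using A by (auto simp: complements_M_def)
  note closed = subalgebra_closed[OF sub]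
  obtain a b c f i where "mat33 a b c 0 (0 + i) f 1 0 i \<in> A" by (rule lift_modulo_M[OF A])
  note closed(2)[OF closed(4)[OF D this] closed(4)[OF closed(4)[OF D this] D]]
  then have q: "mat33 0 0 0 0 0 0 1 0 0 \<in> A" by simp
  obtain a b c f i where "mat33 a b c 0 (0 + i) f 0 1 i \<in> A" by (rule lift_modulo_M[OF A])
  note closed(2)[OF closed(4)[OF D this] closed(4)[OF closed(4)[OF D this] D]]
  then have r: "mat33 0 0 0 0 0 0 0 1 0 \<in> A" by simp
  obtain a b c f d where x: "mat33 a b c 1 (0 + d) f 0 0 d \<in> A" by (rule lift_modulo_M[OF A])
  \<comment> \<open>The Peirce component \<open>(1 - D) X (1 - D) = X - D X - X D + D X D\<close>.\<close>
  note closed(1)[OF closed(2)[OF closed(2)[OF x closed(4)[OF D x]] closed(4)[OF x D]]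
      closed(4)[OF closed(4)[OF D x] D]]
  then have p: "mat33 a b 0 1 d 0 0 0 0 \<in> A" by simp
  define m where "m = a * d - b"
  \<comment> \<open>By Cayley--Hamilton in the corner, \<open>m (1 - D) = (a + d) p - p\<^sup>2\<close>.\<close>
  have "mat33 m 0 0 0 m 0 0 0 m \<in> A"
    using closed(2)[OF closed(1)[OF closed(3)[OF p, of "a + d"] closed(3)[OF D, of m]] closed(4)[OF p p]]
    by (simp add: m_def algebra_simps)
  then have "mat33 m 0 0 0 m 0 0 0 m \<in> A \<inter> M" by (simp add: M_iff)
  then have b: "b = a * d" using disj by (simp add: mat33_constants m_def)
  define s where "s = a + d"
  define T S where "T = mat33 1 (- a) 0 0 1 0 0 0 1" and "S = mat33 1 a 0 0 1 0 0 0 1"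
  have TS: "triangular_pair T S"
    using triangular_pair_unipotent[of "-a" 0 0] by (simp add: T_def S_def)
  define A' where "A' = conj_by T S ` A"
  have A': "complements_M A'" unfolding A'_def by (rule complements_M_conj_by[OF A TS])
  note image = conj_by_imageI[where T = T and S = S and A = A, folded A'_def]
  note calc = conj_by_def T_def S_def s_def b algebra_simps
  have mem: "mat33 0 0 0 0 0 0 0 0 1 \<in> A'" "mat33 0 0 0 1 s 0 0 0 0 \<in> A'"
    "mat33 0 0 0 0 0 0 1 0 0 \<in> A'" "mat33 0 0 0 0 0 0 0 1 0 \<in> A'"
    by (rule image[OF D] image[OF p] image[OF closed(2)[OF q closed(3)[OF r, of a]]] image[OF r];
        simp add: calc)+
  have "has_normal_form A'"
  proof (cases "s = 0")
    case True
    show ?thesis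
    proof (rule has_normal_form_span4[OF A'])
      show "\<exists>k l m n. mat33 a b c d e f g h i - (mscale k (E 2 1) +
          (mscale l (E 3 1) + (mscale m (E 3 2) + mscale n (E 3 3)))) \<in> M" for a b c d e f g h i
        by (intro exI[of _ d] exI[of _ g] exI[of _ h] exI[of _ "i - e"]) (simp add: mat33_constants M_iff)
    qed (use mem True in \<open>auto simp: mat33_constants normal_forms_def\<close>)
  next
    case False
    define T' S' where "T' = mat33 1 0 0 0 s 0 0 0 1" and "S' = mat33 1 0 0 0 (1/s) 0 0 0 1"
    have TS': "triangular_pair T' S'"
      using triangular_pair_torus[of 1 s] False by (simp add: T'_def S'_def)
    define A'' where "A'' = conj_by T' S' ` A'"
    have A'': "complements_M A''" unfolding A''_def by (rule complements_M_conj_by[OF A' TS'])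
    note image = conj_by_imageI[where T = T' and S = S' and A = A', folded A''_def]
    have sub': "subalgebra A'" using A' by (simp add: complements_M_def)
    note scaled = subalgebra_closed(3)[OF sub']
    note calc = conj_by_def T'_def S'_def False
    have mem': "mat33 0 0 0 0 0 0 0 0 1 \<in> A''" "mat33 0 0 0 1 1 0 0 0 0 \<in> A''"
      "mat33 0 0 0 0 0 0 1 0 0 \<in> A''" "mat33 0 0 0 0 0 0 0 1 0 \<in> A''"
      by (rule image[OF mem(1)] image[OF scaled[OF mem(2), of "1/s"]] image[OF mem(3)]
          image[OF scaled[OF mem(4), of s]]; simp add: calc)+
    have "has_normal_form A''"
    proof (rule has_normal_form_span4[OF A''])
      show "\<exists>k l m n. mat33 a b c d e f g h i - (mscale k (E 2 1 + E 2 2) +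
          (mscale l (E 3 1) + (mscale m (E 3 2) + mscale n (E 3 3)))) \<in> M" for a b c d e f g h i
        by (intro exI[of _ d] exI[of _ g] exI[of _ h] exI[of _ "i - e + d"]) (simp add: mat33_constants M_iff)
    qed (use mem' in \<open>auto simp: mat33_constants normal_forms_def\<close>)
    then show ?thesis
      using has_normal_form_conj_by[OF TS'] A''_def by blast
  qed
  then show ?thesis using has_normal_form_conj_by[OF TS] A'_def by blast
qed

text \<open>
  Now the \<open>2 \<times> 2\<close> corner contains its identity \<open>D\<close>, so the element \<open>p\<close> of the corner can be made
  traceless, and then \<open>p\<^sup>2\<close> is the multiple \<open>s\<close> of \<open>D\<close>, whatever \<open>s\<close> is.
\<close>
lemma has_normal_form_if_e11_e22:
  assumes A: "complements_M A" and D: "mat33 1 0 0 0 1 0 0 0 0 \<in> A"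
  shows "has_normal_form A"
proof -
  have sub: "subalgebra A" using A by (auto simp: complements_M_def)
  note closed = subalgebra_closed[OF sub]
  obtain a b c f i where "mat33 a b c 0 (0 + i) f 1 0 i \<in> A" by (rule lift_modulo_M[OF A])
  note closed(2)[OF closed(4)[OF this D] closed(4)[OF D closed(4)[OF this D]]]
  then have q: "mat33 0 0 0 0 0 0 1 0 0 \<in> A" by simp
  obtain a b c f i where "mat33 a b c 0 (0 + i) f 0 1 i \<in> A" by (rule lift_modulo_M[OF A])
  note closed(2)[OF closed(4)[OF this D] closed(4)[OF D closed(4)[OF this D]]]
  then have r: "mat33 0 0 0 0 0 0 0 1 0 \<in> A" by simp
  obtain a b c f d where x: "mat33 a b c 1 (0 + d) f 0 0 d \<in> A" by (rule lift_modulo_M[OF A])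
  define h where "h = (a - d) / 2"
  have "a - (a + d) / 2 = h" "d - (a + d) / 2 = - h"
    by (simp_all add: h_def field_simps)
  then have p: "mat33 h b 0 1 (- h) 0 0 0 0 \<in> A"
    using closed(2)[OF closed(4)[OF closed(4)[OF D x] D] closed(3)[OF D, of "(a + d) / 2"]]
    by simp
  define s where "s = b + h * h"
  define T S where "T = mat33 1 (- h) 0 0 1 0 0 0 1" and "S = mat33 1 h 0 0 1 0 0 0 1"
  have TS: "triangular_pair T S"
    using triangular_pair_unipotent[of "-h" 0 0] by (simp add: T_def S_def)
  define A' where "A' = conj_by T S ` A"
  have A': "complements_M A'" unfolding A'_def by (rule complements_M_conj_by[OF A TS])
  note image = conj_by_imageI[where T = T and S = S and A = A, folded A'_def]
  note calc = conj_by_def T_def S_def s_def algebra_simps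
  have mem: "mat33 1 0 0 0 1 0 0 0 0 \<in> A'" "mat33 0 s 0 1 0 0 0 0 0 \<in> A'"
    "mat33 0 0 0 0 0 0 1 0 0 \<in> A'" "mat33 0 0 0 0 0 0 0 1 0 \<in> A'"
    by (rule image[OF D] image[OF p] image[OF closed(2)[OF q closed(3)[OF r, of h]]] image[OF r];
        simp add: calc)+
  have "has_normal_form A'"
  proof (cases "s = 0")
    case True
    show ?thesis
    proof (rule has_normal_form_span4[OF A'])
      show "\<exists>k l m n. mat33 a b c d e f g h i - (mscale k (E 2 1) +
          (mscale l (E 3 1) + (mscale m (E 3 2) + mscale n (E 1 1 + E 2 2)))) \<in> M" for a b c d e f g h i
        by (intro exI[of _ d] exI[of _ g] exI[of _ h] exI[of _ "e - i"]) (simp add: mat33_constants M_iff)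
    qed (use mem True in \<open>auto simp: mat33_constants normal_forms_def\<close>)
  next
    case False
    \<comment> \<open>Diagonal conjugation takes \<open>e\<^sub>2\<^sub>1 + s e\<^sub>1\<^sub>2\<close> to \<open>k e\<^sub>2\<^sub>1 + (s / k) e\<^sub>1\<^sub>2\<close>; equal coefficients
      require \<open>k\<^sup>2 = s\<close>.\<close>
    define w where "w = csqrt s"
    have w: "w \<noteq> 0" "s = w * w"
      using False by (simp_all add: w_def flip: power2_eq_square)
    define T' S' where "T' = mat33 (1/w) 0 0 0 1 0 0 0 1" and "S' = mat33 w 0 0 0 1 0 0 0 1"
    have TS': "triangular_pair T' S'"
      using triangular_pair_torus[of "1/w" 1] w by (simp add: T'_def S'_def)
    define A'' where "A'' = conj_by T' S' ` A'"
    have A'': "complements_M A''" unfolding A''_def by (rule complements_M_conj_by[OF A' TS'])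
    note image = conj_by_imageI[where T = T' and S = S' and A = A', folded A''_def]
    have sub': "subalgebra A'" using A' by (simp add: complements_M_def)
    note scaled = subalgebra_closed(3)[OF sub', where k = "1/w"]
    note calc = conj_by_def T'_def S'_def w
    have mem': "mat33 1 0 0 0 1 0 0 0 0 \<in> A''" "mat33 0 1 0 1 0 0 0 0 0 \<in> A''"
      "mat33 0 0 0 0 0 0 1 0 0 \<in> A''" "mat33 0 0 0 0 0 0 0 1 0 \<in> A''"
      by (rule image[OF mem(1)] image[OF scaled[OF mem(2)]] image[OF scaled[OF mem(3)]]
          image[OF mem(4)]; simp add: calc)+
    have "has_normal_form A''"
    proof (rule has_normal_form_span4[OF A''])
      show "\<exists>k l m n. mat33 a b c d e f g h i - (mscale k (E 2 1 + E 1 2) +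
          (mscale l (E 3 1) + (mscale m (E 3 2) + mscale n (E 1 1 + E 2 2)))) \<in> M" for a b c d e f g h i
        by (intro exI[of _ d] exI[of _ g] exI[of _ h] exI[of _ "e - i"]) (simp add: mat33_constants M_iff)
    qed (use mem' in \<open>auto simp: mat33_constants normal_forms_def\<close>)
    then show ?thesis
      using has_normal_form_conj_by[OF TS'] A''_def by blast
  qed
  then show ?thesis using has_normal_form_conj_by[OF TS] A'_def by blast
qed

text \<open>
  As for \<open>e\<^sub>2\<^sub>2\<close>, there are elements \<open>e\<^sub>2\<^sub>1 + f e\<^sub>2\<^sub>3\<close> and \<open>b e\<^sub>1\<^sub>2 + e\<^sub>3\<^sub>2\<close>, but now \<open>e\<^sub>2\<^sub>2 = 1 - D\<close> is not
  in \<open>A\<close>. Their product in this order is \<open>(b + f) e\<^sub>2\<^sub>2\<close>, so \<open>f = -b\<close>, and a single conjugation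
  removes both parameters.
\<close>
lemma has_normal_form_if_e11_e33:
  assumes A: "complements_M A" and D: "mat33 1 0 0 0 0 0 0 0 1 \<in> A"
  shows "has_normal_form A"
proof -
  have sub: "subalgebra A" and disj: "A \<inter> M = {0}" using A by (auto simp: complements_M_def)
  note closed = subalgebra_closed[OF sub]
  obtain a b c f i where "mat33 a b c 1 (0 + i) f 0 0 i \<in> A" by (rule lift_modulo_M[OF A])
  note closed(2)[OF closed(4)[OF this D] closed(4)[OF D closed(4)[OF this D]]]
  then have p: "mat33 0 0 0 1 0 f 0 0 0 \<in> A" by simp
  obtain a' b c' f' i' where "mat33 a' b c' 0 (0 + i') f' 0 1 i' \<in> A" by (rule lift_modulo_M[OF A])
  note closed(2)[OF closed(4)[OF D this] closed(4)[OF closed(4)[OF D this] D]]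
  then have r: "mat33 0 b 0 0 0 0 0 1 0 \<in> A" by simp
  define m where "m = b + f"
  have "mat33 m 0 0 0 m 0 0 0 m \<in> A"
    using closed(1)[OF closed(3)[OF D, of m] closed(4)[OF p r]] by (simp add: m_def)
  then have "mat33 m 0 0 0 m 0 0 0 m \<in> A \<inter> M" by (simp add: M_iff)
  then have "m = 0" using disj by (simp add: mat33_constants)
  then have f: "f = - b" by (simp add: m_def eq_neg_iff_add_eq_0 add.commute)
  have q: "mat33 b 0 (b * f) 0 0 0 1 0 f \<in> A" using closed(4)[OF r p] by simp
  define T S where "T = mat33 1 0 (- b) 0 1 0 0 0 1" and "S = mat33 1 0 b 0 1 0 0 0 1"
  have TS: "triangular_pair T S"
    using triangular_pair_unipotent[of 0 "-b" 0] by (simp add: T_def S_def)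
  define A' where "A' = conj_by T S ` A"
  have A': "complements_M A'" unfolding A'_def by (rule complements_M_conj_by[OF A TS])
  note image = conj_by_imageI[where T = T and S = S and A = A, folded A'_def]
  note calc = conj_by_def T_def S_def f algebra_simps
  have mem: "mat33 1 0 0 0 0 0 0 0 1 \<in> A'" "mat33 0 0 0 1 0 0 0 0 0 \<in> A'"
    "mat33 0 0 0 0 0 0 0 1 0 \<in> A'" "mat33 0 0 0 0 0 0 1 0 0 \<in> A'"
    by (rule image[OF D] image[OF p] image[OF r] image[OF q]; simp add: calc)+
  have "has_normal_form A'"
  proof (rule has_normal_form_span4[OF A'])
    show "\<exists>k l m n. mat33 a b c d e f g h i - (mscale k (E 2 1) +
        (mscale l (E 3 1) + (mscale m (E 3 2) + mscale n (E 1 1 + E 3 3)))) \<in> M" for a b c d e f g h i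
      by (intro exI[of _ d] exI[of _ g] exI[of _ h] exI[of _ "i - e"]) (simp add: mat33_constants M_iff)
  qed (use mem in \<open>auto simp: mat33_constants normal_forms_def\<close>)
  then show ?thesis using has_normal_form_conj_by[OF TS] A'_def by blast
qed

lemma complement_of_M_has_normal_form:
  assumes A: "complements_M A"
  shows "has_normal_form A"
proof -
  obtain T S a d where TS: "triangular_pair T S" and ad: "a = 0 \<or> a = 1" "d = 0 \<or> d = 1"
    and D: "mat33 a 0 0 0 d 0 0 0 (1 - d) \<in> conj_by T S ` A"
    by (rule idempotent_diagonalised[OF A])
  have "has_normal_form (conj_by T S ` A)"
    using ad D complements_M_conj_by[OF A TS] has_normal_form_if_e22 has_normal_form_if_e33
      has_normal_form_if_e11_e22 has_normal_form_if_e11_e33 by auto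
  then show ?thesis by (rule has_normal_form_conj_by[OF TS])
qed

section \<open>Automorphisms and antiautomorphisms\<close>

lemma antiautomorphism_iff:
  "antiautomorphism f \<longleftrightarrow>
    bij f \<and> Vector_Spaces.linear mscale mscale f \<and> (\<forall>X Y. f (X ** Y) = f Y ** f X)"
proof -
  have bij: "bij (transpose :: complex^3^3 \<Rightarrow> complex^3^3)"
    by (rule o_bij[of transpose]) auto
  have lin: "Vector_Spaces.linear mscale mscale transpose"
    by (unfold Vector_Spaces.linear_iff, intro conjI allI; (unfold_locales)?)
      (simp_all add: transpose_def mscale_def vec_eq_iff)
  have comp: "bij (f \<circ> transpose) \<and> Vector_Spaces.linear mscale mscale (f \<circ> transpose)"
    if "bij f" "Vector_Spaces.linear mscale mscale f" for f
    using that bij lin by (auto intro: bij_comp Vector_Spaces.linear_compose)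
  show ?thesis
  proof
    assume "antiautomorphism f"
    then show "bij f \<and> Vector_Spaces.linear mscale mscale f \<and> (\<forall>X Y. f (X ** Y) = f Y ** f X)"
      using comp by (auto simp: antiautomorphism_def automorphism_def matrix_transpose_mul)
  next
    assume "bij f \<and> Vector_Spaces.linear mscale mscale f \<and> (\<forall>X Y. f (X ** Y) = f Y ** f X)"
    then have "automorphism (f \<circ> transpose)"
      using comp by (auto simp: automorphism_def matrix_transpose_mul)
    moreover have "f = (f \<circ> transpose) \<circ> transpose" by (simp add: fun_eq_iff)
    ultimately show "antiautomorphism f" unfolding antiautomorphism_def by blast
  qed
qed

lemma inverse_auto_or_anti:
  assumes "automorphism f \<or> antiautomorphism f"
  shows "automorphism (inv f) \<or> antiautomorphism (inv f)"
proof -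
  have f: "bij f" "Vector_Spaces.linear mscale mscale f"
    using assms by (auto simp: automorphism_def antiautomorphism_iff)
  interpret f: Vector_Spaces.linear mscale mscale f by (rule f)
  have inv: "f (inv f X) = X" "inv f (f X) = X" for X
    using f(1) by (simp_all add: bij_def surj_f_inv_f)
  have "Vector_Spaces.linear mscale mscale (inv f)"
  proof (unfold Vector_Spaces.linear_iff, intro conjI allI)
    show "inv f (X + Y) = inv f X + inv f Y" for X Y
      by (metis inv f.add)
    show "inv f (mscale k X) = mscale k (inv f X)" for k X
      by (metis inv f.scale)
  qed (unfold_locales)
  moreover have "bij (inv f)" using f(1) by (rule bij_imp_bij_inv)
  moreover have "(\<forall>X Y. inv f (X ** Y) = inv f X ** inv f Y) \<or>
      (\<forall>X Y. inv f (X ** Y) = inv f Y ** inv f X)"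
  proof -
    consider "\<And>X Y. f (X ** Y) = f X ** f Y" | "\<And>X Y. f (X ** Y) = f Y ** f X"
      using assms by (auto simp: automorphism_def antiautomorphism_iff)
    then show ?thesis
    proof cases
      case 1
      have "inv f (X ** Y) = inv f X ** inv f Y" for X Y
        using inv(2)[of "inv f X ** inv f Y"] by (simp add: 1 inv(1))
      then show ?thesis by blast
    next
      case 2
      have "inv f (X ** Y) = inv f Y ** inv f X" for X Y
        using inv(2)[of "inv f Y ** inv f X"] by (simp add: 2 inv(1))
      then show ?thesis by blast
    qed
  qed
  ultimately show ?thesis by (auto simp: automorphism_def antiautomorphism_iff)
qed

lemma automorphism_comp_auto_or_anti:
  assumes "automorphism g" "automorphism f \<or> antiautomorphism f"
  shows "automorphism (g \<circ> f) \<or> antiautomorphism (g \<circ> f)"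
  using assms
  by (auto simp: automorphism_def antiautomorphism_iff bij_comp Vector_Spaces.linear_compose)

theorem theorem6:
  fixes A B :: "(complex^3^3) set"
  assumes "subalgebra A" and "subalgebra B"
    and "direct_decomposition A B"
    and "mat3.dim A = 4" and "mat3.dim B = 5"
    and "\<exists>\<psi>. (automorphism \<psi> \<or> antiautomorphism \<psi>) \<and> B = \<psi> ` M"
  shows "\<exists>\<phi>. (automorphism \<phi> \<or> antiautomorphism \<phi>) \<and> \<phi> ` B = M \<and>
    (\<phi> ` A = mat3.span {E 2 1, E 2 2, E 3 1, E 3 2} \<or>
     \<phi> ` A = mat3.span {E 2 1, E 3 1, E 3 2, E 3 3} \<or>
     \<phi> ` A = mat3.span {E 2 1, E 3 1, E 3 2, E 1 1 + E 2 2} \<or>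
     \<phi> ` A = mat3.span {E 2 1, E 3 1, E 3 2, E 1 1 + E 3 3} \<or>
     \<phi> ` A = mat3.span {E 1 1 + E 3 1, E 1 2 + E 3 2, E 2 1, E 2 2} \<or>
     \<phi> ` A = mat3.span {E 2 1 + E 1 2, E 3 1, E 3 2, E 1 1 + E 2 2} \<or>
     \<phi> ` A = mat3.span {E 2 1 + E 2 2, E 3 1, E 3 2, E 3 3})"
proof -
  obtain \<psi> where \<psi>: "automorphism \<psi> \<or> antiautomorphism \<psi>" "B = \<psi> ` M"
    using assms(6) by blast
  define f where "f = inv \<psi>"
  have f: "automorphism f \<or> antiautomorphism f"
    unfolding f_def by (rule inverse_auto_or_anti[OF \<psi>(1)])
  have "inj \<psi>" using \<psi>(1) by (auto simp: automorphism_def antiautomorphism_iff bij_def)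
  then have fB: "f ` B = M" by (simp add: f_def \<psi>(2) image_image)
  have "complements_M (f ` A)"
  proof (rule complements_M_image[OF assms(1)])
    fix X
    have "X \<in> {X + Y | X Y. X \<in> A \<and> Y \<in> B}"
      using assms(3) by (simp add: direct_decomposition_def)
    then show "\<exists>Y\<in>A. X - Y \<in> B" by force
  qed (use assms(3) f fB in
      \<open>auto simp: direct_decomposition_def automorphism_def antiautomorphism_iff\<close>)
  then obtain T S where TS: "triangular_pair T S" and nf: "conj_by T S ` f ` A \<in> normal_forms"
    using complement_of_M_has_normal_form unfolding has_normal_form_def by blast
  define \<phi> where "\<phi> = conj_by T S \<circ> f"
  have "automorphism \<phi> \<or> antiautomorphism \<phi>"
    unfolding \<phi>_def by (rule automorphism_comp_auto_or_anti[OF automorphism_conj_by[OF TS] f])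
  moreover have "\<phi> ` B = M"
    using conj_by_image_M[OF TS] fB by (simp only: \<phi>_def image_comp[symmetric])
  moreover have "\<phi> ` A \<in> normal_forms"
    using nf by (simp add: \<phi>_def image_comp)
  ultimately show ?thesis
    unfolding normal_forms_def by blast
qed

end
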